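(* Let $m\ge 1$ be an integer and let $(x_k)_{k\ge 0}$ be generated by Anderson acceleration AA($m$) from an initial guess $x_0\in\mathbb{R}^n$, applied to the linear fixed-point function $q(x)=Mx+b$, with residuals $r_k=x_k-q(x_k)$ and residual polynomials $p_k$. Then for all $s=0,1,2,\ldots$ and $i=1,\ldots,m+1$, $$ r_{s(m+1)+i}=M^{s+1}\,g_{s(m+1)+i-(s+1)}(M)\,r_0, $$ where $g_{s(m+1)+i-(s+1)}(\lambda)$ is a polynomial of degree at most $s(m+1)+i-(s+1)$ and $$\lambda^{s+1}g_{s(m+1)+i-(s+1)}(\lambda)=p_{s(m+1)+i}(\lambda).$$
   Context: Setting: $M\in\mathbb{R}^{n\times n}$, $b\in\mathbb{R}^n$, $q(x)=Mx+b$, $A=I-M$ is nonsingular and $M\neq 0$. $\|\cdot\|$ is the 2-norm. The residual is $r(x)=x-q(x)=Ax-b$ and $r_k=r(x_k)$. AA($m$) with finite window size $m$: given $x_0\in\mathbb{R}^n$, for $k=0,1,2,\ldots$, with $m_k=\min(k,m)$, $$x_{k+1}=q(x_k)+\sum_{i=1}^{m_k}\beta_i^{(k)}\big(q(x_k)-q(x_{k-i})\big)$$ (so $x_1=q(x_0)$). The coefficient vector $\boldsymbol\beta^{(k)}=(\beta_1^{(k)},\ldots,\beta_{m_k}^{(k)})^T$ is the minimum-norm minimizer of $\|r_k+\sum_{i=1}^{m_k}\beta_i(r_k-r_{k-i})\|^2$, i.e. $\boldsymbol\beta^{(k)}=-R_k^{\dagger}r_k$ with $R_k=[\,r_k-r_{k-1}\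 \cdots\ r_k-r_{k-m_k}\,]$ and $\dagger$ the pseudo-inverse. The residual polynomials $p_k$, which satisfy $r_k=p_k(M)r_0$, are defined by $p_0(\lambda)=1$, $p_1(\lambda)=\lambda$, and for $k\ge1$ $$p_{k+1}(\lambda)=\Big(1+\sum_{i=1}^{m_k}\beta_i^{(k)}\Big)\lambda p_k(\lambda)-\sum_{i=1}^{m_k}\beta_i^{(k)}\lambda p_{k-i}(\lambda).$$ *)

theory Defs
  imports "HOL-Analysis.Analysis" "HOL-Computational_Algebra.Polynomial"
begin

(* The library's power on vectors and matrices is componentwise, so powers of a matrix
   with respect to ** are defined here. *)
primrec mat_pow :: "real^'n^'n \<Rightarrow> nat \<Rightarrow> real^'n^'n" where
  "mat_pow M 0 = mat 1"
| "mat_pow M (Suc k) = M ** mat_pow M k"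

definition mat_poly :: "real poly \<Rightarrow> real^'n^'n \<Rightarrow> real^'n^'n" where
  "mat_poly p M = (\<Sum>i\<le>degree p. coeff p i *\<^sub>R mat_pow M i)"

definition fp_map :: "real^'n^'n \<Rightarrow> real^'n \<Rightarrow> real^'n \<Rightarrow> real^'n" where
  "fp_map M b x = M *v x + b"

definition residual :: "real^'n^'n \<Rightarrow> real^'n \<Rightarrow> real^'n \<Rightarrow> real^'n" where
  "residual M b x = x - fp_map M b x"

(* A coefficient vector of length mk is a function of which only the values on {1..mk} matter. *)
definition ls_objective :: "(nat \<Rightarrow> real^'n) \<Rightarrow> nat \<Rightarrow> nat \<Rightarrow> (nat \<Rightarrow> real) \<Rightarrow> real" where
  "ls_objective r k mk \<gamma> = (norm (r k + (\<Sum>i=1..mk. \<gamma> i *\<^sub>R (r k - r (k - i)))))\<^sup>2"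

definition min_norm_minimizer ::
    "(nat \<Rightarrow> real^'n) \<Rightarrow> nat \<Rightarrow> nat \<Rightarrow> (nat \<Rightarrow> real) \<Rightarrow> bool" where
  "min_norm_minimizer r k mk \<gamma> \<longleftrightarrow>
     is_arg_min (\<lambda>\<delta>. L2_set \<delta> {1..mk})
       (\<lambda>\<delta>. is_arg_min (ls_objective r k mk) (\<lambda>_. True) \<delta>) \<gamma>"

(* x are the iterates and \<beta> k is the coefficient vector of step k. For k = 0 the window is
   empty and the recurrence reads x 1 = q (x 0). *)
definition anderson ::
    "real^'n^'n \<Rightarrow> real^'n \<Rightarrow> nat \<Rightarrow> (nat \<Rightarrow> real^'n) \<Rightarrow> (nat \<Rightarrow> nat \<Rightarrow> real) \<Rightarrow> bool" where
  "anderson M b m x \<beta> \<longleftrightarrow>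
     (\<forall>k. min_norm_minimizer (\<lambda>j. residual M b (x j)) k (min k m) (\<beta> k) \<and>
          x (Suc k) = fp_map M b (x k) +
            (\<Sum>i=1..min k m. \<beta> k i *\<^sub>R (fp_map M b (x k) - fp_map M b (x (k - i)))))"

(* The polynomial indeterminate lambda is [:0, 1:]. *)
fun res_poly :: "nat \<Rightarrow> (nat \<Rightarrow> nat \<Rightarrow> real) \<Rightarrow> nat \<Rightarrow> real poly" where
  "res_poly m \<beta> 0 = 1"
| "res_poly m \<beta> (Suc 0) = [:0, 1:]"
| "res_poly m \<beta> (Suc (Suc j)) =
     (let k = Suc j in
       smult (1 + (\<Sum>i=1..min k m. \<beta> k i)) ([:0, 1:] * res_poly m \<beta> k)
       - (\<Sum>i=1..min k m. smult (\<beta> k i) ([:0, 1:] * res_poly m \<beta> (k - i))))"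

end

theory Submission
  imports Defs
begin

text \<open>
  The residual is affine in the iterate, and one fixed-point step multiplies it by \<open>M\<close>. Hence
  the residuals \<open>r\<^sub>k\<close> and the residual polynomials \<open>p\<^sub>k\<close> obey the same recurrence, with
  multiplication by \<open>M\<close> on one side and by the indeterminate \<open>\<lambda>\<close> on the other:
  \<open>p (Suc k) = \<lambda> * (p k + (\<Sum>i=1..min k m. \<beta> k i * (p k - p (k - i))))\<close>
  (\<open>res_poly_Suc\<close> and \<open>residual_anderson_Suc\<close>). Evaluating polynomials at \<open>M\<close> is linear and
  turns \<open>\<lambda>\<close> into \<open>M\<close>, so \<open>r\<^sub>k = p\<^sub>k(M) r\<^sub>0\<close> (\<open>residual_eq_res_poly\<close>).

  The claim thus concerns only the polynomials: \<open>\<lambda>\<close> must divide \<open>p\<^sub>k\<close> at least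
  \<open>\<lceil>k/(m+1)\<rceil>\<close> times. Each step of the recurrence contributes a factor \<open>\<lambda>\<close> and reaches back by
  at most \<open>m + 1\<close> indices, so a common power of \<open>\<lambda>\<close> on a window of \<open>m + 1\<close> consecutive
  polynomials grows by one on the next window (\<open>power_dvd_res_poly\<close>). The degree of \<open>p\<^sub>k\<close> is at
  most \<open>k\<close>, which bounds the degree of the cofactor.
\<close>

section \<open>Polynomials evaluated at a matrix\<close>

text \<open>
  A common summation range for several polynomials is what makes linearity a statement about
  finite sums, since the degree is not additive.
\<close>
lemma mat_poly_eq_sum:
  assumes "degree p \<le> N"
  shows "mat_poly p M = (\<Sum>i\<le>N. coeff p i *\<^sub>R mat_pow M i)"
  unfolding mat_poly_def
  by (rule sum.mono_neutral_left) (use assms in \<open>auto simp: coeff_eq_0\<close>)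

lemma mat_poly_add: "mat_poly (p + q) M = mat_poly p M + mat_poly q M"
proof -
  let ?N = "max (degree p) (degree q)"
  have "degree (p + q) \<le> ?N" by (rule degree_add_le) auto
  then show ?thesis
    by (simp add: mat_poly_eq_sum[where N = ?N] sum.distrib scaleR_add_left)
qed

lemma mat_poly_smult: "mat_poly (smult c p) M = c *\<^sub>R mat_poly p M"
  using degree_smult_le[of c p]
  by (simp add: mat_poly_eq_sum[where N = "degree p"] scaleR_sum_right)

lemma mat_poly_0: "mat_poly 0 M = 0"
  by (simp add: mat_poly_def)

lemma mat_poly_1: "mat_poly 1 M = mat 1"
  by (simp add: mat_poly_def)

lemma mat_poly_diff: "mat_poly (p - q) M = mat_poly p M - mat_poly q M"
  using mat_poly_add[of "p - q" q M] by simp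

lemma mat_poly_sum: "mat_poly (\<Sum>i\<in>I. f i) M = (\<Sum>i\<in>I. mat_poly (f i) M)"
  by (induction I rule: infinite_finite_induct) (simp_all add: mat_poly_0 mat_poly_add)

lemma matrix_scaleR_right: "(A :: real^'n^'m) ** (c *\<^sub>R B) = c *\<^sub>R (A ** B)"
  by (simp add: matrix_matrix_mult_def vec_eq_iff sum_distrib_left mult.left_commute)

lemma matrix_sum_right: "(A :: real^'n^'m) ** (\<Sum>i\<in>I. f i) = (\<Sum>i\<in>I. A ** f i)"
  by (induction I rule: infinite_finite_induct) (simp_all add: matrix_add_ldistrib)

lemma mat_poly_X_mult: "mat_poly ([:0, 1:] * p) M = M ** mat_poly p M"
proof -
  have "mat_poly ([:0, 1:] * p) M
      = (\<Sum>i\<le>Suc (degree p). coeff (pCons 0 p) i *\<^sub>R mat_pow M i)"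
    using degree_pCons_le[of 0 p] by (simp add: mat_poly_eq_sum[where N = "Suc (degree p)"])
  also have "\<dots> = (\<Sum>i\<le>degree p. coeff p i *\<^sub>R (M ** mat_pow M i))"
    by (simp add: sum.atMost_Suc_shift del: sum.atMost_Suc)
  also have "\<dots> = M ** mat_poly p M"
    by (simp add: mat_poly_def matrix_sum_right matrix_scaleR_right)
  finally show ?thesis .
qed

lemma mat_poly_X_power_mult: "mat_poly ([:0, 1:] ^ n * p) M = mat_pow M n ** mat_poly p M"
proof (induction n)
  case (Suc n)
  have "mat_poly ([:0, 1:] ^ Suc n * p) M = mat_poly ([:0, 1:] * ([:0, 1:] ^ n * p)) M"
    by (simp only: power_Suc mult.assoc)
  then show ?case
    by (simp only: mat_poly_X_mult Suc.IH mat_pow.simps matrix_mul_assoc)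
qed simp

section \<open>The residual polynomials\<close>

text \<open>
  Grouping the differences exposes the factor \<open>\<lambda>\<close>, and since the window of step \<open>0\<close> is empty,
  the initial step needs no separate treatment.
\<close>
lemma res_poly_Suc:
  "res_poly m \<beta> (Suc k) = [:0, 1:] * (res_poly m \<beta> k
     + (\<Sum>i=1..min k m. smult (\<beta> k i) (res_poly m \<beta> k - res_poly m \<beta> (k - i))))"
proof (cases k)
  case (Suc j)
  have "(\<Sum>i=1..min k m. smult (\<beta> k i) ([:0, 1:] * res_poly m \<beta> k)) =
      smult (\<Sum>i=1..min k m. \<beta> k i) ([:0, 1:] * res_poly m \<beta> k)"
    by (rule smult_sum[symmetric])
  then show ?thesis
    unfolding Suc
    by (simp add: Let_def smult_add_left smult_diff_right sum_subtractf distrib_left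
        right_diff_distrib sum_distrib_left del: mult_pCons_left)
qed simp

lemma degree_res_poly_le: "degree (res_poly m \<beta> k) \<le> k"
proof (induction k rule: less_induct)
  case (less k)
  show ?case
  proof (cases k)
    case (Suc j)
    let ?s = "res_poly m \<beta> j
      + (\<Sum>i=1..min j m. smult (\<beta> j i) (res_poly m \<beta> j - res_poly m \<beta> (j - i)))"
    have le: "degree (res_poly m \<beta> (j - i)) \<le> j" for i
      using less.IH[of "j - i"] Suc by linarith
    have "degree ?s \<le> j"
    proof (intro degree_add_le degree_sum_le)
      show "degree (res_poly m \<beta> j) \<le> j"
        using le[of 0] by simp
      show "degree (smult (\<beta> j i) (res_poly m \<beta> j - res_poly m \<beta> (j - i))) \<le> j" for i
        using le[of 0] by (intro order.trans[OF degree_smult_le] degree_diff_le le) simp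
    qed simp
    moreover have "degree ([:0, 1:] * ?s) \<le> Suc (degree ?s)"
      using degree_mult_le[of "[:0, 1:]" ?s] by simp
    ultimately show ?thesis
      unfolding Suc res_poly_Suc by linarith
  qed simp
qed

text \<open>
  Every polynomial entering step \<open>k\<close> has index at least \<open>k - m\<close>. If \<open>Suc k\<close> exceeds
  \<open>Suc t * (m + 1)\<close>, these indices exceed \<open>t * (m + 1)\<close>, so by induction all of them
  carry \<open>\<lambda> ^ Suc t\<close>; the step adds one more factor.
\<close>
lemma power_dvd_res_poly:
  assumes "s * (m + 1) < k"
  shows "[:0, 1:] ^ Suc s dvd res_poly m \<beta> k"
  using assms
proof (induction s arbitrary: k)
  case 0
  then obtain j where "k = Suc j" by (cases k) auto
  then show ?case by (simp only: res_poly_Suc power_one_right dvd_triv_left One_nat_def[symmetric])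
next
  case (Suc t)
  then obtain j where j: "k = Suc j" by (cases k) auto
  have window: "[:0, 1:] ^ Suc t dvd res_poly m \<beta> (j - i)" if "i \<le> m" for i
    using Suc.prems that j by (intro Suc.IH) simp
  have "[:0, 1:] ^ Suc t dvd res_poly m \<beta> j
      + (\<Sum>i=1..min j m. smult (\<beta> j i) (res_poly m \<beta> j - res_poly m \<beta> (j - i)))"
    using window[of 0] by (intro dvd_add dvd_sum dvd_smult dvd_diff window) auto
  then show ?case
    unfolding j res_poly_Suc power_Suc[of _ "Suc t"] by (rule mult_dvd_mono[OF dvd_refl])
qed

section \<open>The residuals of Anderson acceleration\<close>

lemma residual_fp_map: "residual M b (fp_map M b x) = M *v residual M b x"
  by (simp add: residual_def fp_map_def matrix_vector_right_distrib matrix_vector_mult_diff_distrib)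

lemma residual_add: "residual M b (x + y) = residual M b x + (y - M *v y)"
  by (simp add: residual_def fp_map_def matrix_vector_right_distrib)

lemma matrix_vector_mult_sum:
  "(M :: real^'n^'m) *v (\<Sum>i\<in>I. c i *\<^sub>R v i) = (\<Sum>i\<in>I. c i *\<^sub>R (M *v v i))"
  by (induction I rule: infinite_finite_induct)
    (simp_all add: matrix_vector_right_distrib matrix_vector_mult_scaleR)

text \<open>
  A difference of two images of the fixed-point map has no constant term, so
  \<open>mat 1 - M\<close> applied to it is the difference of the two residuals, multiplied by \<open>M\<close>.
\<close>
lemma residual_anderson_Suc:
  assumes "anderson M b m x \<beta>"
  shows "residual M b (x (Suc k)) = M *v (residual M b (x k)
    + (\<Sum>i=1..min k m. \<beta> k i *\<^sub>R (residual M b (x k) - residual M b (x (k - i)))))"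
proof -
  let ?q = "\<lambda>j. fp_map M b (x j)" and ?r = "\<lambda>j. residual M b (x j)"
  have diff: "(?q k - ?q j) - M *v (?q k - ?q j) = M *v (?r k - ?r j)" for j
  proof -
    have "(?q k - ?q j) - M *v (?q k - ?q j) = residual M b (?q k) - residual M b (?q j)"
      by (simp add: residual_def fp_map_def matrix_vector_mult_diff_distrib matrix_vector_right_distrib)
    then show ?thesis
      by (simp add: residual_fp_map matrix_vector_mult_diff_distrib)
  qed
  let ?d = "\<Sum>i=1..min k m. \<beta> k i *\<^sub>R (?q k - ?q (k - i))"
  have "x (Suc k) = ?q k + ?d"
    using assms by (simp add: anderson_def)
  then have "residual M b (x (Suc k)) = M *v ?r k + (?d - M *v ?d)"
    by (simp only: residual_add residual_fp_map)
  also have "?d - M *v ?d = (\<Sum>i=1..min k m. \<beta> k i *\<^sub>R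
      ((?q k - ?q (k - i)) - M *v (?q k - ?q (k - i))))"
    by (simp only: matrix_vector_mult_sum sum_subtractf[symmetric] scaleR_diff_right[symmetric])
  also have "\<dots> = M *v (\<Sum>i=1..min k m. \<beta> k i *\<^sub>R (?r k - ?r (k - i)))"
    by (simp only: diff matrix_vector_mult_sum)
  finally show ?thesis
    by (simp only: matrix_vector_right_distrib)
qed

lemma sum_matrix_vector_mult: "(\<Sum>i\<in>I. f i) *v (v :: real^'n) = (\<Sum>i\<in>I. f i *v v)"
  by (induction I rule: infinite_finite_induct) (simp_all add: matrix_vector_mult_add_rdistrib)

lemma residual_eq_res_poly:
  assumes "anderson M b m x \<beta>"
  shows "residual M b (x k) = mat_poly (res_poly m \<beta> k) M *v residual M b (x 0)"
proof (induction k rule: less_induct)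
  case (less k)
  show ?case
  proof (cases k)
    case 0
    then show ?thesis by (simp add: mat_poly_1)
  next
    case (Suc j)
    let ?P = "\<lambda>i. mat_poly (res_poly m \<beta> i) M" and ?r0 = "residual M b (x 0)"
    have IH: "residual M b (x (j - i)) = ?P (j - i) *v ?r0" for i
      using less.IH[of "j - i"] Suc by simp
    have IHj: "residual M b (x j) = ?P j *v ?r0"
      using IH[of 0] by simp
    show ?thesis
      unfolding Suc res_poly_Suc residual_anderson_Suc[OF assms] IH IHj
      by (simp only: mat_poly_X_mult mat_poly_add mat_poly_sum mat_poly_smult mat_poly_diff
          matrix_vector_mul_assoc[symmetric] matrix_vector_mult_add_rdistrib
          sum_matrix_vector_mult scaleR_matrix_vector_assoc[symmetric]
          matrix_vector_mult_diff_rdistrib)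
  qed
qed

section \<open>The factorization\<close>

theorem proposition2p3:
  fixes M :: "real^'n^'n" and b :: "real^'n" and m :: nat
    and x :: "nat \<Rightarrow> real^'n" and \<beta> :: "nat \<Rightarrow> nat \<Rightarrow> real"
  assumes "invertible (mat 1 - M)" and "M \<noteq> 0"
    and "m \<ge> 1"
    and "anderson M b m x \<beta>"
  shows "\<forall>s. \<forall>i\<in>{1..m + 1}. \<exists>g :: real poly.
     degree g \<le> s * (m + 1) + i - (s + 1) \<and>
     residual M b (x (s * (m + 1) + i)) =
       (mat_pow M (s + 1) ** mat_poly g M) *v residual M b (x 0) \<and>
     [:0, 1:] ^ (s + 1) * g = res_poly m \<beta> (s * (m + 1) + i)"
proof (intro allI ballI)
  fix s i :: nat
  assume "i \<in> {1..m + 1}"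
  let ?k = "s * (m + 1) + i"
  have "[:0, 1:] ^ (s + 1) dvd res_poly m \<beta> ?k"
    using power_dvd_res_poly[of s m ?k \<beta>] \<open>i \<in> {1..m + 1}\<close> by simp
  then obtain g where g: "[:0, 1:] ^ (s + 1) * g = res_poly m \<beta> ?k"
    by (metis dvdE)
  have "degree g \<le> ?k - (s + 1)"
  proof (cases "g = 0")
    case False
    then have "degree ([:0, 1:] ^ (s + 1) * g) = (s + 1) + degree g"
      by (simp add: degree_mult_eq degree_power_eq del: power_Suc)
    then show ?thesis
      using degree_res_poly_le[of m \<beta> ?k] unfolding g by linarith
  qed simp
  moreover have "residual M b (x ?k) = (mat_pow M (s + 1) ** mat_poly g M) *v residual M b (x 0)"
    by (simp only: residual_eq_res_poly[OF assms(4), of ?k] g[symmetric] mat_poly_X_power_mult)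
  ultimately show "\<exists>g. degree g \<le> ?k - (s + 1) \<and>
      residual M b (x ?k) = (mat_pow M (s + 1) ** mat_poly g M) *v residual M b (x 0) \<and>
      [:0, 1:] ^ (s + 1) * g = res_poly m \<beta> ?k"
    using g by blast
qed

end
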